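(* Let $t$ be a positive integer and let $S$ be a finite complete set of $t$-translations, with maximum scale $q=\max_{r\in S}\mathrm{sc}(r)$ and maximum shift $s=\max_{r\in S}\mathrm{sh}(r)$. Let $n$ be an integer. If all the numbers $n+1,n+2,\dots,qn+s$ are $t$-representable, then every integer greater than $n$ is $t$-representable.
   Context: For a positive integer $t$, an integer $m$ is $t$-representable if there is a finite set $X$ of distinct positive integers with $\min X \geq t$, $\sum_{x\in X}\frac1x = 1$ and $\sum_{x\in X} x^2 = m$. A tuple of positive integers $r=(k;y_1,\dots,y_l)$ is a $t$-translation if $1-\frac1k = \frac1{y_1}+\dots+\frac1{y_l}$, $t\leq y_1<y_2<\dots<y_l$, and for every $i\in\{1,\dots,l\}$ either $y_i < tk$ or $k\nmid y_i$. Its scale is $\mathrm{sc}(r)=k^2$ and its shift is $\mathrm{sh}(r)=y_1^2+\dots+y_l^2$. A set $S$ of translations is complete if for every integer $m$ there exists $r\in S$ with $m\equiv \mathrm{sh}(r)\pmod{\mathrm{sc}(r)}$.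
   Formalization: The list n+1, …, qn+s is assumed nonempty (n+1 ≤ qn+s), which is automatic for n ≥ 0; for negative n with an empty list, e.g. n = −s, the hypothesis holds vacuously but n+1 ≤ 0 is never t-representable. *)

theory Defs
  imports Complex_Main "HOL-Number_Theory.Cong"
begin

(* Min X is meaningful here: the reciprocal sum being 1 excludes X = {}. *)
definition representable :: "nat \<Rightarrow> int \<Rightarrow> bool" where
  "representable t m \<longleftrightarrow>
     (\<exists>X :: nat set. finite X \<and> (\<forall>x\<in>X. 0 < x) \<and> t \<le> Min X \<and>
        (\<Sum>x\<in>X. 1 / real x) = 1 \<and> (\<Sum>x\<in>X. (int x)\<^sup>2) = m)"

(* The tuple (k; y_1, ..., y_l) is encoded as (k, [y_1, ..., y_l]). *)
type_synonym tuple = "nat \<times> nat list"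

(* The chain t <= y_1 < ... < y_l presupposes l >= 1.  Admitting the empty list would
   add exactly the degenerate tuple (1, []), of scale 1 and shift 0. *)
definition is_translation :: "nat \<Rightarrow> tuple \<Rightarrow> bool" where
  "is_translation t r \<longleftrightarrow>
     (case r of (k, ys) \<Rightarrow>
        0 < k \<and> ys \<noteq> [] \<and> (\<forall>y\<in>set ys. 0 < y) \<and>
        1 - 1 / real k = (\<Sum>y\<leftarrow>ys. 1 / real y) \<and>
        t \<le> hd ys \<and> sorted_wrt (<) ys \<and>
        (\<forall>y\<in>set ys. y < t * k \<or> \<not> k dvd y))"

definition sc :: "tuple \<Rightarrow> nat" where
  "sc r = (fst r)\<^sup>2"

definition sh :: "tuple \<Rightarrow> nat" where
  "sh r = (\<Sum>y\<leftarrow>snd r. y\<^sup>2)"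

definition complete_set :: "tuple set \<Rightarrow> bool" where
  "complete_set S \<longleftrightarrow> (\<forall>m :: int. \<exists>r\<in>S. [m = int (sh r)] (mod int (sc r)))"

end

theory Submission imports Defs begin

text \<open>
  If \<open>X\<close> witnesses that \<open>m\<close> is \<open>t\<close>-representable and \<open>(k; y\<^sub>1, \<dots>, y\<^sub>l)\<close> is a \<open>t\<close>-translation,
  then \<open>k X \<union> {y\<^sub>1, \<dots>, y\<^sub>l}\<close> witnesses that \<open>k\<^sup>2 m + y\<^sub>1\<^sup>2 + \<dots> + y\<^sub>l\<^sup>2\<close> is; the union is disjoint because
  the elements of \<open>k X\<close> are multiples of \<open>k\<close> that are at least \<open>t k\<close>. By completeness, every
  \<open>m > q n + s\<close> arises in this way from some \<open>m'\<close> with \<open>n < m' < m\<close>, and strong induction applies.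
\<close>

text \<open>The empty set has reciprocal sum 0, so a witness has at least one square to sum. This
  yields \<open>0 \<le> n\<close> in the final induction.\<close>

lemma representable_pos:
  assumes "representable t m"
  shows "0 < m"
proof -
  obtain X :: "nat set" where X: "finite X" "\<forall>x\<in>X. 0 < x"
    "(\<Sum>x\<in>X. 1 / real x) = 1" "(\<Sum>x\<in>X. (int x)\<^sup>2) = m"
    using assms unfolding representable_def by auto
  have "X \<noteq> {}"
    using X(3) by auto
  then have "0 < (\<Sum>x\<in>X. (int x)\<^sup>2)"
    using X(1,2) by (intro sum_pos) auto
  then show ?thesis
    using X(4) by simp
qed

text \<open>For \<open>k = 1\<close> a nonempty sum of positive reciprocals would vanish. The strict
  bound makes the final induction descend.\<close>

lemma translation_scale_gt_1:
  assumes "is_translation t r"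
  shows "1 < sc r"
proof -
  obtain k ys where r: "r = (k, ys)"
    by (cases r)
  have ys: "ys \<noteq> []" "\<forall>y\<in>set ys. 0 < y" "1 - 1 / real k = (\<Sum>y\<leftarrow>ys. 1 / real y)" "0 < k"
    using assms unfolding r is_translation_def by auto
  have "0 < (\<Sum>y\<leftarrow>ys. 1 / real y)"
    using ys(1,2)
  proof (induction ys)
    case (Cons y ys)
    \<comment> \<open>The induction hypothesis covers only nonempty tails, so singletons are split
      off.\<close>
    then show ?case by (cases ys) (auto intro: add_pos_pos)
  qed simp
  then have "k \<noteq> 1"
    using ys(3) by auto
  then show ?thesis
    using ys(4) one_less_power[of k 2] by (simp add: r sc_def)
qed

lemma representable_translate:
  assumes "0 < t" "representable t m" "is_translation t r"
  shows "representable t (int (sc r) * m + int (sh r))"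
proof -
  obtain k ys where r: "r = (k, ys)"
    by (cases r)
  have k: "0 < k" and ys_ne: "ys \<noteq> []" and ys_pos: "\<forall>y\<in>set ys. 0 < y"
    and ys_sum: "1 - 1 / real k = (\<Sum>y\<leftarrow>ys. 1 / real y)"
    and ys_hd: "t \<le> hd ys" and ys_sorted: "sorted_wrt (<) ys"
    and ys_div: "\<forall>y\<in>set ys. y < t * k \<or> \<not> k dvd y"
    using assms(3) unfolding r is_translation_def by auto
  obtain X :: "nat set" where X: "finite X" "\<forall>x\<in>X. 0 < x" "t \<le> Min X"
    "(\<Sum>x\<in>X. 1 / real x) = 1" "(\<Sum>x\<in>X. (int x)\<^sup>2) = m"
    using assms(2) unfolding representable_def by auto
  have X_ge: "t \<le> x" if "x \<in> X" for x
    using X(1,3) that Min_le order_trans by blast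
  have ys_ge: "\<forall>y\<in>set ys. t \<le> y"
    using ys_ne ys_hd ys_sorted by (cases ys) auto
  have distinct: "distinct ys"
    using ys_sorted strict_sorted_iff by blast
  have inj: "inj_on ((*) k) X"
    using k by (auto simp: inj_on_def)
  have disj: "(*) k ` X \<inter> set ys = {}"
    using X_ge ys_div by (fastforce simp: mult.commute)
  let ?Y = "(*) k ` X \<union> set ys"
  \<comment> \<open>Kept polymorphic to serve both the real reciprocals and the integer
    squares.\<close>
  have split: "sum f ?Y = (\<Sum>x\<in>X. f (k * x)) + (\<Sum>y\<leftarrow>ys. f y)"
    for f :: "nat \<Rightarrow> 'b::comm_monoid_add"
    using X(1) disj distinct
    by (simp add: sum.union_disjoint sum.reindex[OF inj] sum_list_distinct_conv_sum_set)
  \<comment> \<open>Scaling by \<open>k\<close> shrinks the reciprocal sum of \<open>X\<close> to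
    \<open>1 / k\<close>; the list supplies the missing \<open>1 - 1 / k\<close>.\<close>
  have "(\<Sum>y\<in>?Y. 1 / real y) = 1 / real k * (\<Sum>x\<in>X. 1 / real x) + (1 - 1 / real k)"
    unfolding split ys_sum by (simp add: sum_distrib_left)
  then have recip: "(\<Sum>y\<in>?Y. 1 / real y) = 1"
    using X(4) by simp
  have "(\<Sum>y\<in>?Y. (int y)\<^sup>2) = (int k)\<^sup>2 * (\<Sum>x\<in>X. (int x)\<^sup>2) + (\<Sum>y\<leftarrow>ys. (int y)\<^sup>2)"
    unfolding split by (simp add: sum_distrib_left power_mult_distrib)
  moreover have "int (\<Sum>y\<leftarrow>ys. y\<^sup>2) = (\<Sum>y\<leftarrow>ys. (int y)\<^sup>2)"
    by (induction ys) auto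
  ultimately have squares: "(\<Sum>y\<in>?Y. (int y)\<^sup>2) = int (sc r) * m + int (sh r)"
    using X(5) by (simp add: r sc_def sh_def)
  have ge: "\<forall>y\<in>?Y. t \<le> y"
  proof
    fix y assume "y \<in> ?Y"
    then consider x where "x \<in> X" "y = k * x" | "y \<in> set ys"
      by auto
    then show "t \<le> y"
    proof cases
      case (1 x)
      have "x \<le> k * x" using k by simp
      with 1 X_ge[of x] show ?thesis
        using order_trans by blast
    qed (use ys_ge in auto)
  qed
  have "t \<le> Min ?Y"
    using X(1) ys_ne ge by (intro Min.boundedI) auto
  moreover have "\<forall>y\<in>?Y. 0 < y"
    using ge assms(1) by auto
  ultimately show ?thesis
    unfolding representable_def using X(1) recip squares
    by (intro exI[of _ ?Y]) auto
qed

theorem theorem2: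
  fixes t q s :: nat and S :: "tuple set" and n :: int
  assumes "0 < t"
    and "finite S"
    and "\<forall>r\<in>S. is_translation t r"
    and "complete_set S"
    and "q = Max (sc ` S)"
    and "s = Max (sh ` S)"
    and "n + 1 \<le> int q * n + int s"
    and "\<forall>m\<in>{n + 1..int q * n + int s}. representable t m"
  shows "\<forall>m>n. representable t m"
proof -
  \<comment> \<open>The interval is nonempty, so it contains \<open>n + 1\<close>, which is
    therefore representable and positive.\<close>
  have n: "0 \<le> n"
    using assms(7,8) representable_pos[of t "n + 1"] by auto
  have "representable t m" if "n < m" for m
    using that
  proof (induction "nat m" arbitrary: m rule: less_induct)
    case less
    show ?case
    proof (cases "m \<le> int q * n + int s")
      case True
      then show ?thesis using assms(8) less.prems by auto
    next
      case False
      obtain r where r: "r \<in> S" "[m = int (sh r)] (mod int (sc r))"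
        using assms(4) unfolding complete_set_def by blast
      then obtain m' where "m - int (sh r) = int (sc r) * m'"
        by (auto simp: cong_iff_dvd_diff)
      then have m': "m = int (sc r) * m' + int (sh r)"
        by simp
      have trans: "is_translation t r"
        using assms(3) r(1) by blast
      have sc: "1 < sc r"
        by (rule translation_scale_gt_1[OF trans])
      have le: "sc r \<le> q" "sh r \<le> s"
        using assms(2,5,6) r(1) by auto
      \<comment> \<open>Replacing \<open>q\<close> and \<open>s\<close> by the scale and shift of
        \<open>r\<close> only weakens the bound \<open>m > q n + s\<close>, because \<open>n\<close>
        is nonnegative; cancelling the scale then gives \<open>n < m'\<close>.\<close>
      have "int (sc r) * n \<le> int q * n"
        using le(1) n by (intro mult_right_mono) auto
      then have "int (sc r) * n < int (sc r) * m'"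
        using False le(2) m' by linarith
      then have gt: "n < m'"
        using sc by simp
      \<comment> \<open>Here \<open>m'\<close> is positive and the scale exceeds 1; adding the
        nonnegative shift keeps the inequality strict.\<close>
      have "m' < int (sc r) * m'"
        using sc gt n by simp
      then have "m' < m"
        using m' by linarith
      then have "representable t m'"
        using less.hyps[of m'] gt n by auto
      then show ?thesis
        unfolding m' by (rule representable_translate[OF assms(1) _ trans])
    qed
  qed
  then show ?thesis by blast
qed

end
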